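(* Let $a,b,m,s$ be positive integers. If there exists a magic square $MS(m;s)$ and there exists an $a\times b$ magic rectangle, then there exists a magic rectangle $MR(am,bm;bs,as)$.
   Context: An $a\times b$ magic rectangle is an $a\times b$ array (no empty cells) containing each of $0,1,\ldots,ab-1$ exactly once, with all row sums equal and all column sums equal. For positive integers $m,n,r,s$ with $mr=ns$, $r\le n$, $s\le m$, a magic rectangle $MR(m,n;r,s)$ is an $m\times n$ array in which some cells may be empty, each row contains exactly $r$ filled cells, each column contains exactly $s$ filled cells, the filled cells contain the numbers $0,1,\ldots,mr-1$, each exactly once, all row sums are equal and all column sums are equal. A magic square $MS(m;s)$ is an $MR(m,m;s,s)$. *)

theory Defs
  imports Main
begin

text \<open>
  Arrays are indexed from 0, and only the entries with row index below the number of rows and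
  column index below the number of columns are relevant.
\<close>

definition full_magic_rectangle :: "nat \<Rightarrow> nat \<Rightarrow> (nat \<Rightarrow> nat \<Rightarrow> nat) \<Rightarrow> bool" where
  "full_magic_rectangle a b A \<longleftrightarrow>
     bij_betw (\<lambda>(i, j). A i j) ({..<a} \<times> {..<b}) {..<a * b} \<and>
     (\<exists>\<rho>. \<forall>i<a. (\<Sum>j<b. A i j) = \<rho>) \<and>
     (\<exists>\<sigma>. \<forall>j<b. (\<Sum>i<a. A i j) = \<sigma>)"

text \<open>In an array with empty cells, \<open>None\<close> stands for an empty cell.\<close>

definition row_filled :: "nat \<Rightarrow> (nat \<Rightarrow> nat \<Rightarrow> nat option) \<Rightarrow> nat \<Rightarrow> nat set" where
  "row_filled n A i = {j. j < n \<and> A i j \<noteq> None}"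

definition col_filled :: "nat \<Rightarrow> (nat \<Rightarrow> nat \<Rightarrow> nat option) \<Rightarrow> nat \<Rightarrow> nat set" where
  "col_filled m A j = {i. i < m \<and> A i j \<noteq> None}"

definition filled :: "nat \<Rightarrow> nat \<Rightarrow> (nat \<Rightarrow> nat \<Rightarrow> nat option) \<Rightarrow> (nat \<times> nat) set" where
  "filled m n A = {(i, j). i < m \<and> j < n \<and> A i j \<noteq> None}"

definition magic_rectangle ::
  "nat \<Rightarrow> nat \<Rightarrow> nat \<Rightarrow> nat \<Rightarrow> (nat \<Rightarrow> nat \<Rightarrow> nat option) \<Rightarrow> bool" where
  "magic_rectangle m n r s A \<longleftrightarrow>
     0 < m \<and> 0 < n \<and> 0 < r \<and> 0 < s \<and> m * r = n * s \<and> r \<le> n \<and> s \<le> m \<and>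
     (\<forall>i<m. card (row_filled n A i) = r) \<and>
     (\<forall>j<n. card (col_filled m A j) = s) \<and>
     bij_betw (\<lambda>(i, j). the (A i j)) (filled m n A) {..<m * r} \<and>
     (\<exists>\<rho>. \<forall>i<m. (\<Sum>j\<in>row_filled n A i. the (A i j)) = \<rho>) \<and>
     (\<exists>\<sigma>. \<forall>j<n. (\<Sum>i\<in>col_filled m A j. the (A i j)) = \<sigma>)"

definition magic_square :: "nat \<Rightarrow> nat \<Rightarrow> (nat \<Rightarrow> nat \<Rightarrow> nat option) \<Rightarrow> bool" where
  "magic_square m s A \<longleftrightarrow> magic_rectangle m m s s A"

end

theory Submission
  imports Defs
begin

text \<open>
  Replace every filled cell of the magic square, with entry \<open>v\<close>, by an \<open>a \<times> b\<close> block containing the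
  magic rectangle shifted by \<open>v * (a * b)\<close>, and every empty cell by an empty block. Division with
  remainder by \<open>a * b\<close> recovers \<open>v\<close> and the entry of the rectangle, so all numbers occur exactly once.
\<close>

text \<open>Splits an index of the large array into the index of its block and the offset inside the
  block. In the applications \<open>S\<close> collects the nonempty blocks met by one row, so counts
  and sums along that row become counts and sums over \<open>S \<times> {..<b}\<close>.\<close>

lemma bij_betw_div_mod:
  fixes b :: nat
  assumes "0 < b"
  shows "bij_betw (\<lambda>J. (J div b, J mod b)) {J. J div b \<in> S} (S \<times> {..<b})"
  by (rule bij_betw_byWitness[where f' = "\<lambda>(q, j). q * b + j"]) (use assms in auto)

lemma card_div_mem:
  fixes b :: nat
  assumes "0 < b"
  shows "card {J. J div b \<in> S} = b * card S"
  using bij_betw_same_card[OF bij_betw_div_mod[OF assms, of S]]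
  by (simp add: card_cartesian_product mult.commute)

lemma sum_div_mem:
  fixes b :: nat and h :: "nat \<Rightarrow> nat \<Rightarrow> nat"
  assumes "0 < b"
  shows "(\<Sum>J\<in>{J. J div b \<in> S}. h (J div b) (J mod b)) = (\<Sum>q\<in>S. \<Sum>j<b. h q j)"
  using sum.reindex_bij_betw[OF bij_betw_div_mod[OF assms, of S], of "\<lambda>(q, j). h q j"]
  by (simp add: sum.cartesian_product)

definition inflate ::
  "nat \<Rightarrow> nat \<Rightarrow> (nat \<Rightarrow> nat \<Rightarrow> nat option) \<Rightarrow> (nat \<Rightarrow> nat \<Rightarrow> nat) \<Rightarrow> nat \<Rightarrow> nat \<Rightarrow> nat option" where
  "inflate a b A B I J =
     map_option (\<lambda>v. v * (a * b) + B (I mod a) (J mod b)) (A (I div a) (J div b))"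

text \<open>Together with \<open>inflate_transpose\<close> this reduces columns to rows: transposing
  both ingredients exchanges \<open>a\<close> and \<open>b\<close> but keeps the shift, since
  \<open>a * b = b * a\<close>.\<close>

lemma col_filled_eq_row_filled_transpose:
  "col_filled m A = row_filled m (\<lambda>j i. A i j)"
  by (auto simp: col_filled_def row_filled_def fun_eq_iff)

lemma inflate_transpose:
  "(\<lambda>J I. inflate a b A B I J) = inflate b a (\<lambda>j i. A i j) (\<lambda>j i. B i j)"
  by (simp add: inflate_def fun_eq_iff mult.commute)

text \<open>The bound \<open>J < b * m\<close> amounts to \<open>J div b < m\<close> and is thus
  absorbed into \<open>row_filled m A\<close>.\<close>

lemma row_filled_inflate:
  assumes "0 < b"
  shows "row_filled (b * m) (inflate a b A B) I = {J. J div b \<in> row_filled m A (I div a)}"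
  using assms by (auto simp: row_filled_def inflate_def div_less_iff_less_mult mult.commute)

text \<open>A row crosses one block for each filled cell of a row of \<open>A\<close>. There it
  meets the shift \<open>b\<close> times and one complete row of \<open>B\<close>. Hence its sum is
  constant as soon as \<open>A\<close> has constant row sums and equally many filled cells per row,
  and \<open>B\<close> has constant row sums.\<close>

lemma sum_row_inflate:
  assumes "0 < b"
  shows "(\<Sum>J\<in>row_filled (b * m) (inflate a b A B) I. the (inflate a b A B I J)) =
    b * (a * b) * (\<Sum>q\<in>row_filled m A (I div a). the (A (I div a) q)) +
    card (row_filled m A (I div a)) * (\<Sum>j<b. B (I mod a) j)"
proof -
  have "(\<Sum>J\<in>row_filled (b * m) (inflate a b A B) I. the (inflate a b A B I J)) =
      (\<Sum>J\<in>{J. J div b \<in> row_filled m A (I div a)}.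
        the (A (I div a) (J div b)) * (a * b) + B (I mod a) (J mod b))"
    unfolding row_filled_inflate[OF assms]
    by (rule sum.cong) (auto simp: inflate_def row_filled_def)
  also have "\<dots> = (\<Sum>q\<in>row_filled m A (I div a). \<Sum>j<b.
      the (A (I div a) q) * (a * b) + B (I mod a) j)"
    by (rule sum_div_mem[OF assms])
  also have "\<dots> = b * (a * b) * (\<Sum>q\<in>row_filled m A (I div a). the (A (I div a) q)) +
      card (row_filled m A (I div a)) * (\<Sum>j<b. B (I mod a) j)"
    by (simp add: sum.distrib sum_distrib_left mult_ac)
  finally show ?thesis .
qed

lemma bij_betw_inflate:
  assumes "0 < a" "0 < b"
    and A: "bij_betw (\<lambda>(i, j). the (A i j)) (filled m n A) {..<N}"
    and B: "bij_betw (\<lambda>(i, j). B i j) ({..<a} \<times> {..<b}) {..<a * b}"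
  shows "bij_betw (\<lambda>(I, J). the (inflate a b A B I J))
    (filled (a * m) (b * n) (inflate a b A B)) {..<N * (a * b)}"
proof -
  let ?C = "inflate a b A B"
  have filled_C: "(I, J) \<in> filled (a * m) (b * n) ?C \<longleftrightarrow> (I div a, J div b) \<in> filled m n A" for I J
    using assms(1,2) by (auto simp: filled_def inflate_def div_less_iff_less_mult mult.commute)
  have the_C: "the (?C I J) = the (A (I div a) (J div b)) * (a * b) + B (I mod a) (J mod b)"
    if "(I div a, J div b) \<in> filled m n A" for I J
    using that by (auto simp: filled_def inflate_def)
  have A_less: "the (A i j) < N" if "(i, j) \<in> filled m n A" for i j
    using bij_betwE[OF A] that by fastforce
  have B_less: "B i j < a * b" if "i < a" "j < b" for i j
    using bij_betwE[OF B] that by fastforce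
  have C_div: "the (?C I J) div (a * b) = the (A (I div a) (J div b))"
    and C_mod: "the (?C I J) mod (a * b) = B (I mod a) (J mod b)"
    if "(I div a, J div b) \<in> filled m n A" for I J
    using B_less[of "I mod a" "J mod b"] assms(1,2) that by (simp_all add: the_C)
  show ?thesis
    unfolding bij_betw_def
  proof (intro conjI inj_onI equalityI subsetI)
    fix x y
    assume x: "x \<in> filled (a * m) (b * n) ?C" and y: "y \<in> filled (a * m) (b * n) ?C"
      and eq: "(\<lambda>(I, J). the (?C I J)) x = (\<lambda>(I, J). the (?C I J)) y"
    obtain I J I' J' where xy: "x = (I, J)" "y = (I', J')"
      by (cases x, cases y)
    have x': "(I div a, J div b) \<in> filled m n A" and y': "(I' div a, J' div b) \<in> filled m n A"
      using x y by (simp_all add: xy filled_C)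
    have C_eq: "the (?C I J) = the (?C I' J')"
      using eq by (simp add: xy)
    \<comment> \<open>Equal quotients give the same block by injectivity of \<open>A\<close>; equal
      remainders give the same offset inside it by injectivity of \<open>B\<close>.\<close>
    have "the (A (I div a) (J div b)) = the (A (I' div a) (J' div b))"
      using C_div[OF x'] C_div[OF y'] C_eq by simp
    then have "(I div a, J div b) = (I' div a, J' div b)"
      using inj_onD[OF bij_betw_imp_inj_on[OF A], OF _ x' y'] by simp
    moreover have "B (I mod a) (J mod b) = B (I' mod a) (J' mod b)"
      using C_mod[OF x'] C_mod[OF y'] C_eq by simp
    then have "(I mod a, J mod b) = (I' mod a, J' mod b)"
      using inj_onD[OF bij_betw_imp_inj_on[OF B], of "(I mod a, J mod b)" "(I' mod a, J' mod b)"]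
        assms(1,2) by simp
    ultimately show "x = y"
      by (metis Pair_inject div_mult_mod_eq xy)
  next
    fix z
    assume "z \<in> (\<lambda>(I, J). the (?C I J)) ` filled (a * m) (b * n) ?C"
    then obtain I J where z: "z = the (?C I J)" and IJ: "(I div a, J div b) \<in> filled m n A"
      by (auto simp: filled_C)
    \<comment> \<open>The bound on \<open>z\<close> is equivalent to this bound on its quotient,
      which is an entry of \<open>A\<close>.\<close>
    have "z div (a * b) < N"
      using A_less[OF IJ] C_div[OF IJ] z by simp
    then show "z \<in> {..<N * (a * b)}"
      using assms(1,2) by (simp add: div_less_iff_less_mult)
  next
    fix z
    assume "z \<in> {..<N * (a * b)}"
    then have "z div (a * b) \<in> {..<N}"
      using assms(1,2) by (simp add: div_less_iff_less_mult)
    then obtain p q where pq: "(p, q) \<in> filled m n A" "the (A p q) = z div (a * b)"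
      unfolding bij_betw_imp_surj_on[OF A, symmetric] by auto
    have "z mod (a * b) \<in> {..<a * b}"
      using assms(1,2) by simp
    then obtain i j where ij: "i < a" "j < b" "B i j = z mod (a * b)"
      unfolding bij_betw_imp_surj_on[OF B, symmetric] by auto
    \<comment> \<open>The preimage of \<open>z\<close>: its quotient occurs in \<open>A\<close> at
      \<open>(p, q)\<close>, which selects the block, and its remainder occurs in \<open>B\<close>
      at \<open>(i, j)\<close>, which selects the cell inside that block.\<close>
    have "(p * a + i, q * b + j) \<in> filled (a * m) (b * n) ?C"
      using pq ij by (simp add: filled_C)
    moreover have "the (?C (p * a + i) (q * b + j)) = z"
    proof -
      have "the (?C (p * a + i) (q * b + j)) = the (A p q) * (a * b) + B i j"
        using pq(1) ij(1,2) by (simp add: the_C)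
      also have "\<dots> = z"
        by (simp only: pq(2) ij(3) div_mult_mod_eq)
      finally show ?thesis .
    qed
    ultimately show "z \<in> (\<lambda>(I, J). the (?C I J)) ` filled (a * m) (b * n) ?C"
      by force
  qed
qed

text \<open>The construction is carried out for an arbitrary magic rectangle \<open>A\<close>; the
  theorem is the case \<open>n = m\<close>, \<open>r = s\<close>.\<close>

lemma magic_rectangle_inflate:
  assumes "0 < a" "0 < b" and A: "magic_rectangle m n r s A" and B: "full_magic_rectangle a b B"
  shows "magic_rectangle (a * m) (b * n) (b * r) (a * s) (inflate a b A B)"
proof -
  let ?C = "inflate a b A B"
  note A = A[unfolded magic_rectangle_def] and B = B[unfolded full_magic_rectangle_def]
  obtain \<rho>A \<sigma>A where \<rho>A: "\<And>i. i < m \<Longrightarrow> (\<Sum>j\<in>row_filled n A i. the (A i j)) = \<rho>A"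
    and \<sigma>A: "\<And>j. j < n \<Longrightarrow> (\<Sum>i\<in>col_filled m A j. the (A i j)) = \<sigma>A"
    using A by blast
  obtain \<rho>B \<sigma>B where \<rho>B: "\<And>i. i < a \<Longrightarrow> (\<Sum>j<b. B i j) = \<rho>B"
    and \<sigma>B: "\<And>j. j < b \<Longrightarrow> (\<Sum>i<a. B i j) = \<sigma>B"
    using B by blast
  have col: "card (col_filled (a * m) ?C J) = a * s"
    "(\<Sum>I\<in>col_filled (a * m) ?C J. the (?C I J)) = a * (b * a) * \<sigma>A + s * \<sigma>B"
    if "J < b * n" for J
  proof -
    have J: "J div b < n" "J mod b < b"
      using that assms(2) by (simp_all add: div_less_iff_less_mult mult.commute)
    \<comment> \<open>Phrased through the transpose of \<open>A\<close>, because that is the array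
      to which the row lemmas are applied.\<close>
    have cardA: "card (row_filled m (\<lambda>j i. A i j) (J div b)) = s"
      using A J(1) by (simp add: col_filled_eq_row_filled_transpose)
    then show "card (col_filled (a * m) ?C J) = a * s"
      using assms(1)
      by (simp add: col_filled_eq_row_filled_transpose inflate_transpose row_filled_inflate
          card_div_mem)
    show "(\<Sum>I\<in>col_filled (a * m) ?C J. the (?C I J)) = a * (b * a) * \<sigma>A + s * \<sigma>B"
      \<comment> \<open>The row formula for the transposed arrays, with \<open>a\<close> and
        \<open>b\<close> exchanged; \<open>inflate_transpose\<close> is read from right to left to
        return to the columns of \<open>?C\<close>.\<close>
      using sum_row_inflate[OF assms(1), where a = b and m = m and I = J and A = "\<lambda>j i. A i j"
            and B = "\<lambda>j i. B i j"]
        \<sigma>A[OF J(1)] \<sigma>B[OF J(2)] cardA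
      by (simp add: col_filled_eq_row_filled_transpose flip: inflate_transpose[of a b A B])
  qed
  have row: "card (row_filled (b * n) ?C I) = b * r"
    "(\<Sum>J\<in>row_filled (b * n) ?C I. the (?C I J)) = b * (a * b) * \<rho>A + r * \<rho>B"
    if "I < a * m" for I
  proof -
    have I: "I div a < m" "I mod a < a"
      using that assms(1) by (simp_all add: div_less_iff_less_mult mult.commute)
    show "card (row_filled (b * n) ?C I) = b * r"
      using A I(1) assms(2) by (simp add: row_filled_inflate card_div_mem)
    show "(\<Sum>J\<in>row_filled (b * n) ?C I. the (?C I J)) = b * (a * b) * \<rho>A + r * \<rho>B"
      using A I \<rho>A \<rho>B by (simp add: sum_row_inflate[OF assms(2)])
  qed
  have "bij_betw (\<lambda>(I, J). the (?C I J)) (filled (a * m) (b * n) ?C) {..<a * m * (b * r)}"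
  proof -
    have "m * r * (a * b) = a * m * (b * r)"
      by simp
    then show ?thesis
      using bij_betw_inflate[OF assms(1,2), of A m n "m * r" B] A B by metis
  qed
  moreover have "a * m * (b * r) = b * n * (a * s)"
    using A by (metis mult.assoc mult.left_commute)
  moreover have "0 < a * m" "0 < b * n" "0 < b * r" "0 < a * s" "b * r \<le> b * n" "a * s \<le> a * m"
    using A assms(1,2) by simp_all
  ultimately show ?thesis
    unfolding magic_rectangle_def using row col by blast
qed

theorem theorem9:
  fixes a b m s :: nat
  assumes "0 < a" and "0 < b" and "0 < m" and "0 < s"
    and "\<exists>A. magic_square m s A"
    and "\<exists>B. full_magic_rectangle a b B"
  shows "\<exists>C. magic_rectangle (a * m) (b * m) (b * s) (a * s) C"
  using assms magic_rectangle_inflate unfolding magic_square_def by blast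

end
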